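(* Let $(X_i)_{i\ge1}$ be i.i.d. real random variables with $\mathbb{E}(X_1)=0$ and $\mathbb{V}(X_1)=1$, and assume there is $D>0$ such that $\log\mathbb{E}[\exp(\lambda X_1)]<\infty$ for all $\lambda\in(-D,D)$. For each $k\ge 1$ let $\nu_k$ be a positive-integer-valued random variable, independent of the sequence $(X_i)_i$, with finite expectation $\mu_k=\mathbb{E}(\nu_k)$; assume that $\mu_k\to\infty$, $\nu_k\to\infty$ in probability and $\nu_k/\mu_k\to1$ in probability as $k\to\infty$. Let $0<\alpha<1/2$ and assume that, for some $\beta>2\alpha$, the sequence $(\nu_k/\mu_k)_k$ satisfies an LDP with speed $\mu_k^\beta$ and a good rate function $I$ that has a unique minimum, attained at $x=1$ with value $I(1)=0$ (so $I(x)>0$ for $x\neq1$). Then the sequence $$Z_{k,\alpha}:=\frac{1}{\mu_k^{1/2+\alpha}}\sum_{i=1}^{\nu_k}X_i,\qquad k\ge 1,$$ satisfies an MDP with speed $\mu_k^{2\alpha}$ and rate function $J(x)=x^2/2$.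
   Context: $\mathbb V$ denotes variance. A sequence of real random variables $(Y_k)_k$ satisfies a large deviation principle (LDP) with speed $v(k)$ (where $v(k)\to\infty$) and good rate function $I:\mathbb{R}\to[0,\infty]$ if: (i) for every $L\in[0,\infty)$ the level set $\{x\in\mathbb R: I(x)\le L\}$ is compact; (ii) for every open $G\subseteq\mathbb{R}$, $\liminf_{k\to\infty}\frac{1}{v(k)}\log\mathbb{P}(Y_k\in G)\ge-\inf_{x\in G}I(x)$; (iii) for every closed $A\subseteq\mathbb{R}$, $\limsup_{k\to\infty}\frac{1}{v(k)}\log\mathbb{P}(Y_k\in A)\le-\inf_{x\in A}I(x)$, with $\log 0=-\infty$ and $\inf\emptyset=+\infty$. Formally there is no distinction between a moderate deviation principle (MDP) and an LDP: "MDP with speed $v(k)$ and rate function $J$" means exactly that (i)--(iii) hold for $J$. *)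

theory Defs
  imports "HOL-Probability.Probability"
begin

text \<open>The extended logarithm, with \<open>log 0 = -\<infinity>\<close> and \<open>log \<infinity> = \<infinity>\<close>;
  the library's \<^const>\<open>ln\<close> on the reals has \<open>ln 0 = 0\<close>.\<close>

definition ln_ennreal :: "ennreal \<Rightarrow> ereal" where
  "ln_ennreal p = (if p = 0 then -\<infinity> else if p = \<infinity> then \<infinity> else ereal (ln (enn2real p)))"

text \<open>Sequences are indexed by \<open>k \<ge> 1\<close>; values at index \<open>0\<close> are irrelevant.
  The infimum over the empty set is \<open>\<infinity>\<close> because it is taken in \<^typ>\<open>ereal\<close>.\<close>

definition satisfies_LDP ::
  "'a measure \<Rightarrow> (nat \<Rightarrow> 'a \<Rightarrow> real) \<Rightarrow> (nat \<Rightarrow> real) \<Rightarrow> (real \<Rightarrow> ereal) \<Rightarrow> bool" where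
  "satisfies_LDP M Y v I \<longleftrightarrow>
     (\<forall>k\<ge>1. Y k \<in> borel_measurable M) \<and>
     filterlim v at_top sequentially \<and>
     (\<forall>x. 0 \<le> I x) \<and>
     (\<forall>L::real. 0 \<le> L \<longrightarrow> compact {x. I x \<le> ereal L}) \<and>
     (\<forall>G. open G \<longrightarrow>
        - (INF x\<in>G. I x) \<le>
        liminf (\<lambda>k. ereal (1 / v k) * ln_ennreal (emeasure M {\<omega> \<in> space M. Y k \<omega> \<in> G}))) \<and>
     (\<forall>A. closed A \<longrightarrow>
        limsup (\<lambda>k. ereal (1 / v k) * ln_ennreal (emeasure M {\<omega> \<in> space M. Y k \<omega> \<in> A}))
        \<le> - (INF x\<in>A. I x))"

text \<open>Independence of two random elements via the sigma-algebras they generate. The library's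
  \<open>indep_var\<close> requires both to take values in the same type.\<close>

definition indep_random_elements ::
  "'a measure \<Rightarrow> 'b measure \<Rightarrow> ('a \<Rightarrow> 'b) \<Rightarrow> 'c measure \<Rightarrow> ('a \<Rightarrow> 'c) \<Rightarrow> bool" where
  "indep_random_elements M S Y T Z \<longleftrightarrow>
     Y \<in> measurable M S \<and> Z \<in> measurable M T \<and>
     prob_space.indep_set M
       (sets (vimage_algebra (space M) Y S)) (sets (vimage_algebra (space M) Z T))"

definition converges_in_prob :: "'a measure \<Rightarrow> (nat \<Rightarrow> 'a \<Rightarrow> real) \<Rightarrow> real \<Rightarrow> bool" where
  "converges_in_prob M Y c \<longleftrightarrow>
     (\<forall>\<epsilon>>0. (\<lambda>k. measure M {\<omega> \<in> space M. \<bar>Y k \<omega> - c\<bar> > \<epsilon>}) \<longlonglongrightarrow> 0)"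

definition diverges_in_prob :: "'a measure \<Rightarrow> (nat \<Rightarrow> 'a \<Rightarrow> real) \<Rightarrow> bool" where
  "diverges_in_prob M Y \<longleftrightarrow>
     (\<forall>K::real. (\<lambda>k. measure M {\<omega> \<in> space M. Y k \<omega> > K}) \<longlonglongrightarrow> 1)"

end

theory Submission
  imports Defs
begin

text \<open>With \<open>a = \<mu>\<^sub>k powr (2 * \<alpha>)\<close>, the LDP for \<open>\<nu>\<^sub>k / \<mu>\<^sub>k\<close> runs at a faster speed, so the complement of
  \<open>E = {\<bar>\<nu>\<^sub>k / \<mu>\<^sub>k - 1\<bar> < d}\<close> has probability below \<open>exp (- R a)\<close> for every \<open>R\<close>. On \<open>E\<close>, conditioning on
  \<open>\<nu>\<^sub>k\<close> and expanding the moment generating function of \<open>X\<^sub>1\<close> at \<open>0\<close> shows that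
  \<open>E[exp (\<theta> a Z\<^sub>k); E]\<close> is \<open>exp (a (\<theta>\<^sup>2 / 2 + O(d)))\<close>. Truncating to \<open>E\<close> is necessary, because
  \<open>\<nu>\<^sub>k\<close> need not have exponential moments. The truncated transforms yield the upper bound by Chernoff's inequality
  and the lower bound by exponential tilting, as in the Gartner-Ellis theorem.\<close>

section \<open>Second-order expansion of the moment generating function at 0\<close>

lemma exp_cubic_remainder:
  fixes y :: real
  shows "\<bar>exp y - 1 - y - y\<^sup>2 / 2\<bar> \<le> exp \<bar>y\<bar> * \<bar>y\<bar> ^ 3 / 2"
proof -
  have "norm (exp y - (\<Sum>i\<le>2. y ^ i / fact i)) \<le> exp (norm y) * (norm y ^ Suc 2) / fact 2"
    by (rule Taylor_exp_field)
  then show ?thesis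
    by (simp add: numeral_2_eq_2 numeral_3_eq_3 algebra_simps)
qed

text \<open>Used to absorb the cubic factor of a Taylor remainder into an exponential. The constant
  \<open>27 = 3 ^ 3\<close> comes from cubing \<open>z \<le> exp z\<close> at
  \<open>z = y / 3\<close>.\<close>

lemma power3_le_exp:
  fixes y :: real
  assumes "0 \<le> y"
  shows "y ^ 3 \<le> 27 * exp y"
proof -
  have "(y / 3) ^ 3 \<le> (exp (y / 3)) ^ 3"
    using assms exp_ge_add_one_self[of "y / 3"] by (intro power_mono) linarith+
  also have "\<dots> = exp y"
    by (simp flip: exp_of_nat_mult)
  finally show ?thesis
    by (simp add: power_divide)
qed

text \<open>Pointwise, the second-order Taylor remainder of \<open>exp (t * X)\<close> is at most
  \<open>\<bar>t\<bar> ^ 3\<close> times an integrable variable that does not depend on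
  \<open>t\<close>. Taking expectations removes the linear term by the mean and turns the quadratic
  one into \<open>t\<^sup>2 / 2\<close> by the second moment.\<close>

lemma (in prob_space) standardized_mgf_cubic_remainder:
  fixes X :: "'a \<Rightarrow> real"
  assumes "D > 0" and int_exp: "\<And>t. \<bar>t\<bar> < D \<Longrightarrow> integrable M (\<lambda>\<omega>. exp (t * X \<omega>))"
    and int: "integrable M X" "integrable M (\<lambda>\<omega>. (X \<omega>)\<^sup>2)"
    and mean: "expectation X = 0" and sq: "expectation (\<lambda>\<omega>. (X \<omega>)\<^sup>2) = 1"
  obtains C where "C \<ge> 0"
    "\<And>t. \<bar>t\<bar> \<le> D / 4 \<Longrightarrow> \<bar>expectation (\<lambda>\<omega>. exp (t * X \<omega>)) - 1 - t\<^sup>2 / 2\<bar> \<le> C * \<bar>t\<bar> ^ 3"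
proof
  \<comment> \<open>The exponent \<open>D / 2\<close> is spent in two halves: \<open>D / 4\<close>
    covers \<open>exp \<bar>t * X\<bar>\<close> and another \<open>D / 4\<close> absorbs
    \<open>\<bar>X\<bar> ^ 3\<close>. As \<open>D / 2 < D\<close>, both exponentials are integrable,
    and their sum dominates \<open>exp (D / 2 * \<bar>X\<bar>)\<close> whatever the sign of
    \<open>X\<close>.\<close>
  define G where "G = (\<lambda>\<omega>. 27 / (D / 4) ^ 3 * (exp (D / 2 * X \<omega>) + exp (- (D / 2) * X \<omega>)))"
  have int_G: "integrable M G"
    unfolding G_def using \<open>D > 0\<close> by (intro integrable_mult_right Bochner_Integration.integrable_add int_exp) auto
  show "expectation G / 2 \<ge> 0"
    using \<open>D > 0\<close> by (auto simp: G_def intro!: divide_nonneg_nonneg integral_nonneg mult_nonneg_nonneg add_nonneg_nonneg)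
  fix t :: real
  assume t: "\<bar>t\<bar> \<le> D / 4"
  let ?R = "\<lambda>\<omega>. exp (t * X \<omega>) - 1 - t * X \<omega> - t\<^sup>2 * (X \<omega>)\<^sup>2 / 2"
  have intt: "integrable M (\<lambda>\<omega>. exp (t * X \<omega>))"
    using t \<open>D > 0\<close> by (intro int_exp) auto
  have int_R: "integrable M ?R"
    using int intt by auto
  have "expectation ?R = expectation (\<lambda>\<omega>. exp (t * X \<omega>)) - 1 - t\<^sup>2 / 2"
    using int intt mean sq by (simp add: prob_space)
  moreover have "\<bar>?R \<omega>\<bar> \<le> G \<omega> / 2 * \<bar>t\<bar> ^ 3" for \<omega>
  proof -
    let ?x = "\<bar>X \<omega>\<bar>"
    have "exp \<bar>t * X \<omega>\<bar> * ?x ^ 3 \<le> exp (D / 4 * ?x) * (27 / (D / 4) ^ 3 * exp (D / 4 * ?x))"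
    proof (rule mult_mono)
      show "exp \<bar>t * X \<omega>\<bar> \<le> exp (D / 4 * ?x)"
        using mult_right_mono[OF t, of ?x] by (simp add: abs_mult)
      have "(D / 4) ^ 3 * ?x ^ 3 \<le> 27 * exp (D / 4 * ?x)"
        using power3_le_exp[of "D / 4 * ?x"] \<open>D > 0\<close> by (simp add: power_mult_distrib power_divide)
      then show "?x ^ 3 \<le> 27 / (D / 4) ^ 3 * exp (D / 4 * ?x)"
        using \<open>D > 0\<close> by (simp add: field_simps)
    qed auto
    also have "\<dots> = 27 / (D / 4) ^ 3 * exp (D / 2 * ?x)"
      by (simp add: field_simps flip: exp_add)
    also have "exp (D / 2 * ?x) \<le> exp (D / 2 * X \<omega>) + exp (- (D / 2) * X \<omega>)"
      by (cases "X \<omega> \<ge> 0") auto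
    finally have *: "exp \<bar>t * X \<omega>\<bar> * ?x ^ 3 \<le> G \<omega>"
      using \<open>D > 0\<close> by (simp only: G_def) (simp add: divide_right_mono)
    have "\<bar>?R \<omega>\<bar> \<le> exp \<bar>t * X \<omega>\<bar> * \<bar>t * X \<omega>\<bar> ^ 3 / 2"
      using exp_cubic_remainder[of "t * X \<omega>"] by (simp add: power_mult_distrib)
    also have "\<dots> = (exp \<bar>t * X \<omega>\<bar> * ?x ^ 3) / 2 * \<bar>t\<bar> ^ 3"
      by (simp add: abs_mult power_mult_distrib)
    also have "\<dots> \<le> G \<omega> / 2 * \<bar>t\<bar> ^ 3"
      using * by (intro mult_right_mono) auto
    finally show ?thesis .
  qed
  then have "\<bar>expectation ?R\<bar> \<le> expectation (\<lambda>\<omega>. G \<omega> / 2 * \<bar>t\<bar> ^ 3)"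
    using int_G int_R by (intro order_trans[OF integral_abs_bound] integral_mono) auto
  ultimately show "\<bar>expectation (\<lambda>\<omega>. exp (t * X \<omega>)) - 1 - t\<^sup>2 / 2\<bar> \<le> expectation G / 2 * \<bar>t\<bar> ^ 3"
    by simp
qed

text \<open>The additive expansion is put into exponential form so that powers of it can be taken.
  The upper bound is \<open>1 + y \<le> exp y\<close>; the lower one is
  \<open>y - y\<^sup>2 \<le> ln (1 + y)\<close>, where \<open>y\<^sup>2\<close> is again of order
  \<open>\<bar>t\<bar> ^ 3\<close>. This extra term is the reason why the witness is
  \<open>C + 1\<close> for the \<open>C\<close> of the cubic remainder.\<close>

lemma (in prob_space) standardized_mgf_bounds:
  fixes X :: "'a \<Rightarrow> real"
  assumes "D > 0" and int_exp: "\<And>t. \<bar>t\<bar> < D \<Longrightarrow> integrable M (\<lambda>\<omega>. exp (t * X \<omega>))"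
    and int: "integrable M X" "integrable M (\<lambda>\<omega>. (X \<omega>)\<^sup>2)"
    and mean: "expectation X = 0" and sq: "expectation (\<lambda>\<omega>. (X \<omega>)\<^sup>2) = 1"
  obtains r C where "0 < r" "r < D" "0 \<le> C"
    "\<And>t. \<bar>t\<bar> \<le> r \<Longrightarrow> expectation (\<lambda>\<omega>. exp (t * X \<omega>)) \<in> {exp (t\<^sup>2 * (1 / 2 - C * \<bar>t\<bar>)) .. exp (t\<^sup>2 * (1 / 2 + C * \<bar>t\<bar>))}"
proof -
  obtain C where C: "C \<ge> 0"
    "\<And>t. \<bar>t\<bar> \<le> D / 4 \<Longrightarrow> \<bar>expectation (\<lambda>\<omega>. exp (t * X \<omega>)) - 1 - t\<^sup>2 / 2\<bar> \<le> C * \<bar>t\<bar> ^ 3"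
    using standardized_mgf_cubic_remainder[OF assms] by metis
  \<comment> \<open>\<open>D / 4\<close> is the range of the expansion, \<open>1\<close> gives
    \<open>t\<^sup>2 \<le> \<bar>t\<bar>\<close>, and \<open>1 / (2 * C + 1)\<close> gives
    \<open>C * \<bar>t\<bar> \<le> 1 / 2\<close>. Together they place \<open>?y\<close> in
    \<open>[0, 1]\<close>, where the lower bound for the logarithm is valid.\<close>
  define r where "r = min (D / 4) (min 1 (1 / (2 * C + 1)))"
  have r: "0 < r" "r \<le> D / 4" "r \<le> 1" "r \<le> 1 / (2 * C + 1)"
    using \<open>D > 0\<close> C(1) unfolding r_def by (simp_all only: min_less_iff_conj, auto)
  show thesis
  proof
    show "0 < r" "r < D" "0 \<le> C + 1" using r C \<open>D > 0\<close> by auto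
    fix t :: real
    assume t: "\<bar>t\<bar> \<le> r"
    let ?phi = "expectation (\<lambda>\<omega>. exp (t * X \<omega>))" and ?y = "t\<^sup>2 * (1 / 2 - C * \<bar>t\<bar>)"
    have t3: "\<bar>t\<bar> ^ 3 = t\<^sup>2 * \<bar>t\<bar>" by (simp add: power3_eq_cube power2_eq_square)
    have bound: "\<bar>?phi - 1 - t\<^sup>2 / 2\<bar> \<le> t\<^sup>2 * (C * \<bar>t\<bar>)"
      using C(2)[of t] t r by (simp add: t3 mult_ac)
    have Ct: "C * \<bar>t\<bar> \<le> 1 / 2"
    proof -
      have "C * \<bar>t\<bar> \<le> C * (1 / (2 * C + 1))"
        using t r C by (intro mult_left_mono) auto
      also have "\<dots> \<le> 1 / 2" using C by (simp add: field_simps)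
      finally show ?thesis .
    qed
    have y: "0 \<le> ?y" "?y \<le> t\<^sup>2 / 2"
      using Ct mult_left_mono[of "1 / 2 - C * \<bar>t\<bar>" "1 / 2" "t\<^sup>2"] C by (auto intro!: mult_nonneg_nonneg)
    have t2: "t\<^sup>2 \<le> \<bar>t\<bar>" "t\<^sup>2 \<le> 1"
      using t r mult_left_mono[of "\<bar>t\<bar>" 1 "\<bar>t\<bar>"] by (auto simp: power2_eq_square abs_square_le_1[unfolded power2_eq_square])
    have "?y\<^sup>2 \<le> (t\<^sup>2 / 2)\<^sup>2" using y by (intro power_mono)
    also have "\<dots> \<le> t\<^sup>2 * \<bar>t\<bar>"
      using mult_left_mono[OF t2(1), of "t\<^sup>2"] mult_nonneg_nonneg[of "t\<^sup>2" "\<bar>t\<bar>"]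
      by (simp add: power2_eq_square field_simps)
    finally have "t\<^sup>2 * (1 / 2 - (C + 1) * \<bar>t\<bar>) \<le> ?y - ?y\<^sup>2"
      by (simp add: algebra_simps)
    also have "\<dots> \<le> ln (1 + ?y)"
      using y t2 by (intro ln_one_plus_pos_lower_bound) auto
    finally have "exp (t\<^sup>2 * (1 / 2 - (C + 1) * \<bar>t\<bar>)) \<le> 1 + ?y"
      using y by (subst (asm) ln_ge_iff) auto
    also have "\<dots> \<le> ?phi" using bound by (simp add: algebra_simps)
    finally have low: "exp (t\<^sup>2 * (1 / 2 - (C + 1) * \<bar>t\<bar>)) \<le> ?phi" .
    have "?phi \<le> 1 + t\<^sup>2 * (1 / 2 + (C + 1) * \<bar>t\<bar>)"
      using bound mult_nonneg_nonneg[OF abs_ge_zero[of t] zero_le_power2[of t]]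
      by (simp add: algebra_simps abs_le_iff del: zero_le_mult_iff mult_nonneg_nonneg)
    also have "\<dots> \<le> exp (t\<^sup>2 * (1 / 2 + (C + 1) * \<bar>t\<bar>))"
      by (rule exp_ge_add_one_self)
    finally show "?phi \<in> {exp (t\<^sup>2 * (1 / 2 - (C + 1) * \<bar>t\<bar>)) .. exp (t\<^sup>2 * (1 / 2 + (C + 1) * \<bar>t\<bar>))}"
      using low by simp
  qed
qed


section \<open>Exponential moments of sums with deterministic and random length\<close>

lemma (in prob_space) mgf_iid_sum:
  fixes X :: "nat \<Rightarrow> 'a \<Rightarrow> real"
  assumes indep: "indep_vars (\<lambda>_. borel) X {1..}"
    and ident: "\<And>i. i \<ge> 1 \<Longrightarrow> distr M borel (X i) = distr M borel (X 1)"
    and int: "integrable M (\<lambda>\<omega>. exp (t * X 1 \<omega>))"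
  shows "integrable M (\<lambda>\<omega>. exp (t * (\<Sum>i=1..n. X i \<omega>)))"
    and "expectation (\<lambda>\<omega>. exp (t * (\<Sum>i=1..n. X i \<omega>))) = expectation (\<lambda>\<omega>. exp (t * X 1 \<omega>)) ^ n"
proof -
  have rv[measurable]: "X i \<in> borel_measurable M" if "i \<ge> 1" for i
    using indep that by (auto simp: indep_vars_def)
  have "indep_vars (\<lambda>_. borel) X {1..n}"
    using indep by (rule indep_vars_subset) auto
  then have ind: "indep_vars (\<lambda>_. borel) (\<lambda>i \<omega>. exp (t * X i \<omega>)) {1..n}"
    by (rule indep_vars_compose2) auto
  have inti: "integrable M (\<lambda>\<omega>. exp (t * X i \<omega>))" if "i \<ge> 1" for i
  proof -
    have "integrable (distr M borel (X 1)) (\<lambda>x. exp (t * x))"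
      using int by (subst integrable_distr_eq) (auto simp: rv)
    then have "integrable (distr M borel (X i)) (\<lambda>x. exp (t * x))"
      using ident[OF that] by simp
    then show ?thesis
      by (subst (asm) integrable_distr_eq) (use that in \<open>auto simp: rv\<close>)
  qed
  have expi: "expectation (\<lambda>\<omega>. exp (t * X i \<omega>)) = expectation (\<lambda>\<omega>. exp (t * X 1 \<omega>))" if "i \<ge> 1" for i
    using integral_distr[of "X i" M borel "\<lambda>x. exp (t * x)"] integral_distr[of "X 1" M borel "\<lambda>x. exp (t * x)"]
      ident[OF that] rv that by simp
  have *: "exp (t * (\<Sum>i=1..n. X i \<omega>)) = (\<Prod>i=1..n. exp (t * X i \<omega>))" for \<omega>
    by (simp add: sum_distrib_left exp_sum)
  show "integrable M (\<lambda>\<omega>. exp (t * (\<Sum>i=1..n. X i \<omega>)))"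
    unfolding * by (rule indep_vars_integrable[OF _ ind]) (auto intro: inti)
  show "expectation (\<lambda>\<omega>. exp (t * (\<Sum>i=1..n. X i \<omega>))) = expectation (\<lambda>\<omega>. exp (t * X 1 \<omega>)) ^ n"
  proof -
    have "(\<Prod>i=1..n. expectation (\<lambda>\<omega>. exp (t * X i \<omega>))) = (\<Prod>i=1..n. expectation (\<lambda>\<omega>. exp (t * X 1 \<omega>)))"
      by (intro prod.cong refl expi) auto
    then show ?thesis
      unfolding * by (subst indep_vars_lebesgue_integral[OF _ ind]) (auto intro: inti)
  qed
qed

text \<open>Conditioning on the length: on \<open>N = n\<close> the random sum is a deterministic
  one, which is independent of that event. Since \<open>B\<close> is finite, only finitely many
  lengths contribute, so integrability follows without any exponential moment of
  \<open>N\<close>.\<close>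

lemma (in prob_space) mgf_random_sum:
  fixes X :: "nat \<Rightarrow> 'a \<Rightarrow> real" and N :: "'a \<Rightarrow> nat"
  assumes X_indep: "indep_vars (\<lambda>_. borel) X {1..}"
    and ident: "\<And>i. i \<ge> 1 \<Longrightarrow> distr M borel (X i) = distr M borel (X 1)"
    and int: "integrable M (\<lambda>\<omega>. exp (t * X 1 \<omega>))"
    and N_indep: "indep_random_elements M (count_space UNIV) N
            (PiM {1..} (\<lambda>_. borel)) (\<lambda>\<omega>. \<lambda>i\<in>{1..}. X i \<omega>)"
    and "finite B"
  shows "integrable M (\<lambda>\<omega>. indicator {\<omega>. N \<omega> \<in> B} \<omega> * exp (t * (\<Sum>i=1..N \<omega>. X i \<omega>)))" (is ?int)
    and "expectation (\<lambda>\<omega>. indicator {\<omega>. N \<omega> \<in> B} \<omega> * exp (t * (\<Sum>i=1..N \<omega>. X i \<omega>)))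
      = (\<Sum>n\<in>B. prob {\<omega> \<in> space M. N \<omega> = n} * expectation (\<lambda>\<omega>. exp (t * X 1 \<omega>)) ^ n)" (is ?eq)
proof -
  let ?S = "\<lambda>n \<omega>. exp (t * (\<Sum>i=1..n. X i \<omega>))"
  let ?X = "\<lambda>\<omega>. \<lambda>i\<in>{1..}. X i \<omega>"
  let ?T = "PiM {1..} (\<lambda>_. borel) :: (nat \<Rightarrow> real) measure"
  have N[measurable]: "N \<in> measurable M (count_space UNIV)" and X: "?X \<in> measurable M ?T"
    and ind: "indep_set (sets (vimage_algebra (space M) N (count_space UNIV))) (sets (vimage_algebra (space M) ?X ?T))"
    using N_indep by (auto simp: indep_random_elements_def)
  \<comment> \<open>The indicator is a function of \<open>N\<close> and \<open>?S n\<close> a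
    function of the sequence, so they generate smaller sigma-algebras and inherit independence. Both
    are real valued, so the product rule for expectations applies to them.\<close>
  have iv: "indep_var borel (indicator {\<omega>. N \<omega> = n} :: 'a \<Rightarrow> real) borel (?S n)" for n
  proof -
    define g :: "(nat \<Rightarrow> real) \<Rightarrow> real" where "g = (\<lambda>x. exp (t * (\<Sum>i=1..n. x i)))"
    have g[measurable]: "g \<in> borel_measurable ?T" unfolding g_def by measurable
    have S: "?S n = (\<lambda>\<omega>. g (?X \<omega>))" by (auto simp: g_def)
    have "sets (vimage_algebra (space M) (indicator {\<omega>. N \<omega> = n} :: 'a \<Rightarrow> real) borel)
        \<subseteq> sets (vimage_algebra (space M) N (count_space UNIV))"
      unfolding sets_vimage_algebra
    proof (rule sigma_sets_mono', safe)
      fix A :: "real set"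
      have "indicator {\<omega>. N \<omega> = n} -` A \<inter> space M = N -` {m. (if m = n then 1 else 0) \<in> A} \<inter> space M"
        by (auto simp: indicator_def)
      then show "\<exists>A'. indicator {\<omega>. N \<omega> = n} -` A \<inter> space M = N -` A' \<inter> space M \<and> A' \<in> sets (count_space UNIV)"
        by (intro exI[of _ "{m. (if m = n then 1 else 0) \<in> A}"]) simp
    qed
    moreover have "sets (vimage_algebra (space M) (?S n) borel) \<subseteq> sets (vimage_algebra (space M) ?X ?T)"
      unfolding sets_vimage_algebra
    proof (rule sigma_sets_mono', safe)
      fix A :: "real set"
      assume "A \<in> sets borel"
      then have "g -` A \<inter> space ?T \<in> sets ?T" by (rule measurable_sets[OF g])
      moreover have "?S n -` A \<inter> space M = ?X -` (g -` A \<inter> space ?T) \<inter> space M"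
        unfolding S using measurable_space[OF X] by auto
      ultimately show "\<exists>A'. ?S n -` A \<inter> space M = ?X -` A' \<inter> space M \<and> A' \<in> sets ?T"
        by blast
    qed
    ultimately have "indep_set (sets (vimage_algebra (space M) (indicator {\<omega>. N \<omega> = n} :: 'a \<Rightarrow> real) borel))
        (sets (vimage_algebra (space M) (?S n) borel))"
      using ind unfolding indep_sets2_eq by blast
    moreover have "?S n \<in> borel_measurable M"
      unfolding S by (rule measurable_compose[OF X g])
    moreover have "(indicator {\<omega>. N \<omega> = n} :: 'a \<Rightarrow> real) \<in> borel_measurable M"
      by measurable
    ultimately show ?thesis
      unfolding indep_var_eq sets_vimage_algebra by simp
  qed
  have int_ind: "integrable M (indicator {\<omega>. N \<omega> = n} :: 'a \<Rightarrow> real)" for n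
    by (rule integrable_const_bound[of _ 1]) (auto simp: indicator_def)
  have E_ind: "expectation (indicator {\<omega>. N \<omega> = n}) = prob {\<omega> \<in> space M. N \<omega> = n}" for n
    by (auto intro!: arg_cong[where f = prob])
  have mgf: "integrable M (?S n)" "expectation (?S n) = expectation (\<lambda>\<omega>. exp (t * X 1 \<omega>)) ^ n" for n
    by (intro mgf_iid_sum X_indep ident int; assumption)+
  have int_n: "integrable M (\<lambda>\<omega>. indicator {\<omega>. N \<omega> = n} \<omega> * ?S n \<omega>)" for n
    by (rule indep_var_integrable[OF iv int_ind mgf(1)])
  have E_n: "expectation (\<lambda>\<omega>. indicator {\<omega>. N \<omega> = n} \<omega> * ?S n \<omega>)
      = prob {\<omega> \<in> space M. N \<omega> = n} * expectation (\<lambda>\<omega>. exp (t * X 1 \<omega>)) ^ n" for n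
    using indep_var_lebesgue_integral[OF iv int_ind mgf(1)] by (simp only: E_ind mgf(2))
  \<comment> \<open>For each outcome at most one summand on the right survives, the one with
    \<open>n = N \<omega>\<close>.\<close>
  have split: "indicator {\<omega>. N \<omega> \<in> B} \<omega> * exp (t * (\<Sum>i=1..N \<omega>. X i \<omega>))
      = (\<Sum>n\<in>B. indicator {\<omega>. N \<omega> = n} \<omega> * ?S n \<omega>)" for \<omega>
    using \<open>finite B\<close> by (simp add: indicator_def if_distrib[where f = "\<lambda>x. x * _"] sum.delta' cong: if_cong)
  show ?int
    unfolding split by (intro Bochner_Integration.integrable_sum int_n)
  show ?eq
    unfolding split E_n[symmetric] by (intro Bochner_Integration.integral_sum int_n)
qed

section \<open>Probability bounds from truncated exponential moments\<close>

text \<open>Together with its mirror image below, this reduces both large deviation bounds to real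
  inequalities between probabilities and exponentials. At \<open>p = 0\<close> the scaled logarithm
  is \<open>-\<infinity>\<close>, in agreement with \<open>0 \<le> exp (c * v)\<close>.\<close>

lemma scaled_ln_ennreal_le_iff:
  assumes "0 < v" "0 \<le> p"
  shows "ereal (1 / v) * ln_ennreal (ennreal p) \<le> ereal c \<longleftrightarrow> p \<le> exp (c * v)"
proof (cases "p = 0")
  case False
  then have "ln p \<le> c * v \<longleftrightarrow> p \<le> exp (c * v)"
    using assms by (metis exp_le_cancel_iff exp_ln less_eq_real_def)
  then show ?thesis
    using assms False by (auto simp: ln_ennreal_def field_simps)
qed (use assms in \<open>simp add: ln_ennreal_def\<close>)

lemma le_scaled_ln_ennreal_iff:
  assumes "0 < v" "0 \<le> p"
  shows "ereal c \<le> ereal (1 / v) * ln_ennreal (ennreal p) \<longleftrightarrow> exp (c * v) \<le> p"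
proof (cases "p = 0")
  case False
  then have "c * v \<le> ln p \<longleftrightarrow> exp (c * v) \<le> p"
    using assms by (metis exp_le_cancel_iff exp_ln less_eq_real_def)
  then show ?thesis
    using assms False by (auto simp: ln_ennreal_def field_simps)
qed (use assms in \<open>simp add: ln_ennreal_def\<close>)

lemma eventually_const_le_exp:
  assumes "filterlim a at_top F" "(c::real) > 0"
  shows "eventually (\<lambda>k. C \<le> exp (a k * c)) F"
proof -
  have "filterlim (\<lambda>k. exp (a k * c)) at_top F"
    using assms by (intro filterlim_compose[OF exp_at_top] filterlim_at_top_mult_tendsto_pos[OF tendsto_const]) auto
  then show ?thesis by (simp add: filterlim_at_top)
qed

text \<open>Outside \<open>E\<close> the event is bounded trivially; on \<open>E\<close>, Markov's
  inequality is applied with \<open>\<theta> = r\<close> for the right tail and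
  \<open>\<theta> = - r\<close> for the left one. These parameters are optimal for a Gaussian
  transform: \<open>- a * r\<^sup>2 + a * r\<^sup>2 / 2\<close> is the exponent
  \<open>- a * r\<^sup>2 / 2\<close>.\<close>

lemma (in prob_space) truncated_Chernoff:
  assumes [measurable]: "Y \<in> borel_measurable M" "E \<in> events"
    and int: "\<And>\<theta>. \<theta> \<in> {r, - r} \<Longrightarrow> integrable M (\<lambda>\<omega>. indicator E \<omega> * exp (\<theta> * a * Y \<omega>))"
    and "a \<ge> 0" "r \<ge> 0"
  shows "prob {\<omega> \<in> space M. r \<le> \<bar>Y \<omega>\<bar>} \<le> prob (space M - E)
    + exp (- a * r\<^sup>2) * expectation (\<lambda>\<omega>. indicator E \<omega> * exp (r * a * Y \<omega>))
    + exp (- a * r\<^sup>2) * expectation (\<lambda>\<omega>. indicator E \<omega> * exp (- r * a * Y \<omega>))"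
proof -
  let ?f = "\<lambda>\<theta> \<omega>. indicator E \<omega> * exp (\<theta> * a * Y \<omega>)"
  let ?A = "{\<omega> \<in> space M. r \<le> \<bar>Y \<omega>\<bar>}"
  have int': "integrable M (?f r)" "integrable M (?f (- r))"
    "integrable M (indicator ?A :: 'a \<Rightarrow> real)" "integrable M (indicator (space M - E) :: 'a \<Rightarrow> real)"
    using int[of r] int[of "- r"] by (simp_all add: less_top[symmetric])
  have "expectation (indicator ?A)
      \<le> expectation (\<lambda>\<omega>. indicator (space M - E) \<omega> + exp (- a * r\<^sup>2) * ?f r \<omega> + exp (- a * r\<^sup>2) * ?f (- r) \<omega>)"
  proof (intro integral_mono)
    fix \<omega> assume \<omega>: "\<omega> \<in> space M"
    have ar: "0 \<le> a * r" using assms by simp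
    have "1 \<le> exp (- a * r\<^sup>2) * exp (r * a * Y \<omega>)" if "r \<le> Y \<omega>"
      using mult_left_mono[OF that ar] by (simp add: power2_eq_square algebra_simps flip: exp_add)
    moreover have "1 \<le> exp (- a * r\<^sup>2) * exp (- r * a * Y \<omega>)" if "r \<le> - Y \<omega>"
      using mult_left_mono[OF that ar] by (simp add: power2_eq_square algebra_simps flip: exp_add)
    moreover have "0 \<le> exp (- a * r\<^sup>2) * exp (r * a * Y \<omega>)" "0 \<le> exp (- a * r\<^sup>2) * exp (- r * a * Y \<omega>)"
      by simp_all
    ultimately have "r \<le> \<bar>Y \<omega>\<bar> \<Longrightarrow> 1 \<le> exp (- a * r\<^sup>2) * exp (r * a * Y \<omega>) + exp (- a * r\<^sup>2) * exp (- r * a * Y \<omega>)"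
      by (cases "Y \<omega> \<ge> 0") (smt (verit))+
    then show "indicator ?A \<omega> \<le> indicator (space M - E) \<omega> + exp (- a * r\<^sup>2) * ?f r \<omega> + exp (- a * r\<^sup>2) * ?f (- r) \<omega>"
      using \<omega> by (auto simp: indicator_def)
  qed (intro Bochner_Integration.integrable_add integrable_mult_right int')+
  also have "\<dots> = prob (space M - E) + exp (- a * r\<^sup>2) * expectation (?f r) + exp (- a * r\<^sup>2) * expectation (?f (- r))"
    using int' by simp
  finally show ?thesis by simp
qed

text \<open>The last two terms are Chernoff bounds for \<open>Y \<ge> x + h\<close> and \<open>Y \<le> x - h\<close> under the tilting weight
  \<open>exp (x a Y)\<close>; no tilted measure has to be constructed.\<close>

lemma (in prob_space) truncated_tilting:
  assumes [measurable]: "Y \<in> borel_measurable M" "E \<in> events"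
    and int: "\<And>\<theta>. \<theta> \<in> {x, x + h, x - h} \<Longrightarrow> integrable M (\<lambda>\<omega>. indicator E \<omega> * exp (\<theta> * a * Y \<omega>))"
    and "a \<ge> 0" "h \<ge> 0"
  shows "expectation (\<lambda>\<omega>. indicator E \<omega> * exp (x * a * Y \<omega>))
    \<le> exp (a * (x\<^sup>2 + \<bar>x\<bar> * h)) * prob {\<omega> \<in> space M. \<bar>Y \<omega> - x\<bar> < h}
    + exp (- a * h * (x + h)) * expectation (\<lambda>\<omega>. indicator E \<omega> * exp ((x + h) * a * Y \<omega>))
    + exp (a * h * (x - h)) * expectation (\<lambda>\<omega>. indicator E \<omega> * exp ((x - h) * a * Y \<omega>))"
proof -
  let ?f = "\<lambda>\<theta> \<omega>. indicator E \<omega> * exp (\<theta> * a * Y \<omega>)"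
  let ?A = "{\<omega> \<in> space M. \<bar>Y \<omega> - x\<bar> < h}"
  have int': "integrable M (?f x)" "integrable M (?f (x + h))" "integrable M (?f (x - h))"
    "integrable M (indicator ?A :: 'a \<Rightarrow> real)"
    using int[of x] int[of "x + h"] int[of "x - h"] by (simp_all add: less_top[symmetric])
  have "expectation (?f x)
      \<le> expectation (\<lambda>\<omega>. exp (a * (x\<^sup>2 + \<bar>x\<bar> * h)) * indicator ?A \<omega> + exp (- a * h * (x + h)) * ?f (x + h) \<omega>
          + exp (a * h * (x - h)) * ?f (x - h) \<omega>)"
  proof (intro integral_mono)
    fix \<omega> assume \<omega>: "\<omega> \<in> space M"
    have ah: "0 \<le> a * h" using assms by simp
    have pos: "0 \<le> exp (- a * h * (x + h)) * ?f (x + h) \<omega>" "0 \<le> exp (a * h * (x - h)) * ?f (x - h) \<omega>"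
      "0 \<le> exp (a * (x\<^sup>2 + \<bar>x\<bar> * h)) * indicator ?A \<omega>"
      by simp_all
    consider "\<omega> \<in> ?A" | "x + h \<le> Y \<omega>" | "Y \<omega> \<le> x - h" using \<omega> by fastforce
    then show "?f x \<omega> \<le> exp (a * (x\<^sup>2 + \<bar>x\<bar> * h)) * indicator ?A \<omega> + exp (- a * h * (x + h)) * ?f (x + h) \<omega>
          + exp (a * h * (x - h)) * ?f (x - h) \<omega>"
    proof cases
      case 1
      have "x * (Y \<omega> - x) \<le> \<bar>x\<bar> * \<bar>Y \<omega> - x\<bar>"
        by (metis abs_ge_self abs_mult)
      also have "\<dots> \<le> \<bar>x\<bar> * h" using 1 by (intro mult_left_mono) auto
      finally have "x * Y \<omega> \<le> x\<^sup>2 + \<bar>x\<bar> * h" by (simp add: power2_eq_square algebra_simps)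
      then have "?f x \<omega> \<le> exp (a * (x\<^sup>2 + \<bar>x\<bar> * h)) * indicator ?A \<omega>"
        using 1 \<open>a \<ge> 0\<close> mult_left_mono[of "x * Y \<omega>" "x\<^sup>2 + \<bar>x\<bar> * h" a]
        by (auto simp: indicator_def mult_ac)
      then show ?thesis using pos by linarith
    next
      case 2
      then have "?f x \<omega> \<le> exp (- a * h * (x + h)) * ?f (x + h) \<omega>"
        using mult_left_mono[OF 2 ah] by (auto simp: indicator_def algebra_simps simp flip: exp_add)
      then show ?thesis using pos by linarith
    next
      case 3
      then have "?f x \<omega> \<le> exp (a * h * (x - h)) * ?f (x - h) \<omega>"
        using mult_left_mono[OF 3 ah] by (auto simp: indicator_def algebra_simps simp flip: exp_add)
      then show ?thesis using pos by linarith
    qed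
  qed (intro Bochner_Integration.integrable_add integrable_mult_right int')+
  also have "\<dots> = exp (a * (x\<^sup>2 + \<bar>x\<bar> * h)) * prob ?A + exp (- a * h * (x + h)) * expectation (?f (x + h))
    + exp (a * h * (x - h)) * expectation (?f (x - h))"
    using int' by simp
  finally show ?thesis .
qed

text \<open>A Gartner-Ellis criterion for the limit \<open>\<theta>\<^sup>2 / 2\<close>, which is
  its own Legendre transform. The rate increases with \<open>\<bar>x\<bar>\<close>, so closed sets
  need only two-sided tails and open sets only small intervals. The events \<open>E k\<close> may
  depend on \<open>B\<close> and \<open>\<delta>\<close> but not on \<open>\<theta>\<close>, because
  tilting compares three values of \<open>\<theta>\<close> on the same event.\<close>

lemma (in prob_space) LDP_Gaussian_rate_if_truncated_mgf:
  fixes Y :: "nat \<Rightarrow> 'a \<Rightarrow> real" and a :: "nat \<Rightarrow> real"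
  assumes meas: "\<And>k. k \<ge> 1 \<Longrightarrow> Y k \<in> borel_measurable M"
    and a: "filterlim a at_top sequentially"
    and trunc: "\<And>B \<delta>. \<delta> > 0 \<Longrightarrow> \<exists>E. (\<forall>k. k \<ge> 1 \<longrightarrow> E k \<in> events) \<and>
      (\<forall>R. \<forall>\<^sub>F k in sequentially. prob (space M - E k) \<le> exp (- R * a k)) \<and>
      (\<forall>\<theta>. \<bar>\<theta>\<bar> \<le> B \<longrightarrow> (\<forall>\<^sub>F k in sequentially.
        integrable M (\<lambda>\<omega>. indicator (E k) \<omega> * exp (\<theta> * a k * Y k \<omega>)) \<and>
        expectation (\<lambda>\<omega>. indicator (E k) \<omega> * exp (\<theta> * a k * Y k \<omega>))
          \<in> {exp (a k * (\<theta>\<^sup>2 / 2 - \<delta>)) .. exp (a k * (\<theta>\<^sup>2 / 2 + \<delta>))}))"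
  shows "satisfies_LDP M Y a (\<lambda>x. ereal (x\<^sup>2 / 2))"
proof -
  have a_pos: "\<forall>\<^sub>F k in sequentially. 1 \<le> k \<and> 0 < a k"
    using a by (auto simp: filterlim_at_top_dense eventually_conj_iff eventually_ge_at_top)
  have upper: "\<forall>\<^sub>F k in sequentially. prob {\<omega> \<in> space M. r \<le> \<bar>Y k \<omega>\<bar>} \<le> exp (- (r\<^sup>2 / 2 - \<epsilon>) * a k)"
    if "r > 0" "\<epsilon> > 0" for r \<epsilon>
  proof -
    obtain E where E: "\<And>k. k \<ge> 1 \<Longrightarrow> E k \<in> events"
      "\<And>R. \<forall>\<^sub>F k in sequentially. prob (space M - E k) \<le> exp (- R * a k)"
      "\<And>\<theta>. \<bar>\<theta>\<bar> \<le> r \<Longrightarrow> \<forall>\<^sub>F k in sequentially.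
        integrable M (\<lambda>\<omega>. indicator (E k) \<omega> * exp (\<theta> * a k * Y k \<omega>)) \<and>
        expectation (\<lambda>\<omega>. indicator (E k) \<omega> * exp (\<theta> * a k * Y k \<omega>))
          \<in> {exp (a k * (\<theta>\<^sup>2 / 2 - \<epsilon> / 2)) .. exp (a k * (\<theta>\<^sup>2 / 2 + \<epsilon> / 2))}"
      using trunc[of "\<epsilon> / 2" r] \<open>\<epsilon> > 0\<close> by force
    \<comment> \<open>With \<open>R = r\<^sup>2 / 2 - \<epsilon> / 2\<close> the complement of
      \<open>E k\<close> has the same bound as each of the two Chernoff terms. The resulting factor
      3 is absorbed by the other \<open>\<epsilon> / 2\<close>.\<close>
    have "\<bar>r\<bar> \<le> r" "\<bar>- r\<bar> \<le> r" "\<epsilon> / 2 > 0" using that by auto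
    from a_pos E(2)[of "r\<^sup>2 / 2 - \<epsilon> / 2"] E(3)[OF this(1)] E(3)[OF this(2)] eventually_const_le_exp[OF a this(3), of 3]
    show ?thesis
    proof eventually_elim
      case (elim k)
      define W where "W = (\<lambda>\<theta>. expectation (\<lambda>\<omega>. indicator (E k) \<omega> * exp (\<theta> * a k * Y k \<omega>)))"
      let ?q = "exp (- (r\<^sup>2 / 2 - \<epsilon> / 2) * a k)"
      have "prob {\<omega> \<in> space M. r \<le> \<bar>Y k \<omega>\<bar>} \<le> prob (space M - E k) + exp (- a k * r\<^sup>2) * W r + exp (- a k * r\<^sup>2) * W (- r)"
        unfolding W_def using elim that by (intro truncated_Chernoff meas E(1)) auto
      also have "\<dots> \<le> ?q + exp (- a k * r\<^sup>2) * exp (a k * (r\<^sup>2 / 2 + \<epsilon> / 2))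
          + exp (- a k * r\<^sup>2) * exp (a k * ((- r)\<^sup>2 / 2 + \<epsilon> / 2))"
        using elim unfolding W_def by (intro add_mono mult_left_mono) (auto simp: algebra_simps)
      also have "\<dots> = 3 * ?q"
        by (simp add: algebra_simps flip: exp_add)
      also have "\<dots> \<le> exp (a k * (\<epsilon> / 2)) * ?q"
        using elim by (intro mult_right_mono) auto
      also have "\<dots> = exp (- (r\<^sup>2 / 2 - \<epsilon>) * a k)"
        by (simp add: algebra_simps flip: exp_add)
      finally show ?case .
    qed
  qed
  have lower: "\<forall>\<^sub>F k in sequentially. exp (- (x\<^sup>2 / 2 + \<epsilon>) * a k) \<le> prob {\<omega> \<in> space M. \<bar>Y k \<omega> - x\<bar> < \<eta>}"
    if "\<eta> > 0" "\<epsilon> > 0" for x \<eta> \<epsilon>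
  proof -
    \<comment> \<open>\<open>h \<le> \<eta>\<close> keeps the interval inside the target,
      \<open>h \<le> 1\<close> keeps the tilts \<open>x + h\<close> and \<open>x - h\<close> within
      \<open>\<bar>x\<bar> + 1\<close>, and the last bound makes the total loss
      \<open>\<bar>x\<bar> * h + h\<^sup>2 / 8\<close> at most
      \<open>\<epsilon> / 2\<close>.\<close>
    define h where "h = min (min \<eta> 1) (\<epsilon> / (2 * (\<bar>x\<bar> + 1)))"
    have h: "0 < h" "h \<le> \<eta>" "h \<le> 1" "h \<le> \<epsilon> / (2 * (\<bar>x\<bar> + 1))"
      using that unfolding h_def by auto
    have "(\<bar>x\<bar> + 1) * h \<le> \<epsilon> / 2"
      using h(4) by (simp add: field_simps add_pos_nonneg)
    moreover have h2: "h\<^sup>2 \<le> h" using h by (simp add: power2_eq_square mult_left_le)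
    ultimately have h\<epsilon>: "\<bar>x\<bar> * h + h\<^sup>2 / 8 \<le> \<epsilon> / 2" using h(1) by (simp add: algebra_simps)
    \<comment> \<open>Per unit of \<open>a k\<close>, each tail term has exponent at most
      \<open>x\<^sup>2 / 2 - h\<^sup>2 / 2 + \<delta>\<close>, while the tilted total has at least
      \<open>x\<^sup>2 / 2 - \<delta>\<close>. With this \<open>\<delta>\<close> a gap of
      \<open>h\<^sup>2 / 4\<close> remains, so the tilted mass concentrates near
      \<open>x\<close>.\<close>
    define \<delta> where "\<delta> = h\<^sup>2 / 8"
    have "\<delta> > 0" using h by (simp add: \<delta>_def)
    then obtain E where E: "\<And>k. k \<ge> 1 \<Longrightarrow> E k \<in> events"
      "\<And>\<theta>. \<bar>\<theta>\<bar> \<le> \<bar>x\<bar> + 1 \<Longrightarrow> \<forall>\<^sub>F k in sequentially.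
        integrable M (\<lambda>\<omega>. indicator (E k) \<omega> * exp (\<theta> * a k * Y k \<omega>)) \<and>
        expectation (\<lambda>\<omega>. indicator (E k) \<omega> * exp (\<theta> * a k * Y k \<omega>))
          \<in> {exp (a k * (\<theta>\<^sup>2 / 2 - \<delta>)) .. exp (a k * (\<theta>\<^sup>2 / 2 + \<delta>))}"
      using trunc[of \<delta> "\<bar>x\<bar> + 1"] by force
    have "\<bar>x\<bar> \<le> \<bar>x\<bar> + 1" "\<bar>x + h\<bar> \<le> \<bar>x\<bar> + 1" "\<bar>x - h\<bar> \<le> \<bar>x\<bar> + 1" "h\<^sup>2 / 4 > 0" "\<epsilon> / 2 > 0"
      using h \<open>\<epsilon> > 0\<close> by auto
    from a_pos E(2)[OF this(1)] E(2)[OF this(2)] E(2)[OF this(3)] eventually_const_le_exp[OF a this(4), of 4]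
      eventually_const_le_exp[OF a this(5), of 2]
    show ?thesis
    proof eventually_elim
      case (elim k)
      define W where "W = (\<lambda>\<theta>. expectation (\<lambda>\<omega>. indicator (E k) \<omega> * exp (\<theta> * a k * Y k \<omega>)))"
      let ?P = "prob {\<omega> \<in> space M. \<bar>Y k \<omega> - x\<bar> < h}"
      let ?q = "exp (a k * (x\<^sup>2 / 2 - h\<^sup>2 / 8))" and ?s = "exp (a k * (x\<^sup>2 / 2 - 3 * h\<^sup>2 / 8))"
      have [measurable]: "Y k \<in> borel_measurable M" using elim meas by auto
      have "?q \<le> W x"
        using elim by (simp add: W_def \<delta>_def)
      also have "\<dots> \<le> exp (a k * (x\<^sup>2 + \<bar>x\<bar> * h)) * ?P
          + exp (- a k * h * (x + h)) * W (x + h) + exp (a k * h * (x - h)) * W (x - h)"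
        unfolding W_def using elim h by (intro truncated_tilting meas E(1)) auto
      also have "\<dots> \<le> exp (a k * (x\<^sup>2 + \<bar>x\<bar> * h)) * ?P
          + exp (- a k * h * (x + h)) * exp (a k * ((x + h)\<^sup>2 / 2 + \<delta>))
          + exp (a k * h * (x - h)) * exp (a k * ((x - h)\<^sup>2 / 2 + \<delta>))"
        unfolding W_def using elim by (intro add_mono mult_left_mono) auto
      also have "\<dots> = exp (a k * (x\<^sup>2 + \<bar>x\<bar> * h)) * ?P + 2 * ?s"
        by (simp add: \<delta>_def power2_eq_square algebra_simps add_divide_distrib diff_divide_distrib flip: exp_add)
      \<comment> \<open>Since \<open>4 \<le> exp (a k * (h\<^sup>2 / 4))\<close>, both tails
        together take at most half of \<open>?q\<close>; the other half must come from the interval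
        around \<open>x\<close>.\<close>
      also have "2 * ?s \<le> exp (a k * (h\<^sup>2 / 4)) / 2 * ?s"
        using elim by (intro mult_right_mono) auto
      also have "\<dots> = ?q / 2"
        by (simp add: algebra_simps flip: exp_add)
      finally have "?q \<le> 2 * (exp (a k * (x\<^sup>2 + \<bar>x\<bar> * h)) * ?P)"
        by simp
      also have "\<dots> \<le> exp (a k * (\<epsilon> / 2)) * (exp (a k * (x\<^sup>2 + \<bar>x\<bar> * h)) * ?P)"
        using elim by (intro mult_right_mono) auto
      also have "\<dots> = exp (a k * (\<epsilon> / 2 + x\<^sup>2 + \<bar>x\<bar> * h)) * ?P"
        by (simp add: algebra_simps exp_add)
      finally have "exp (- a k * (\<epsilon> / 2 + x\<^sup>2 + \<bar>x\<bar> * h)) * ?q \<le>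
          exp (- a k * (\<epsilon> / 2 + x\<^sup>2 + \<bar>x\<bar> * h)) * (exp (a k * (\<epsilon> / 2 + x\<^sup>2 + \<bar>x\<bar> * h)) * ?P)"
        by (intro mult_left_mono) auto
      also have "\<dots> = ?P"
        by (simp add: mult.assoc[symmetric] flip: exp_add)
      finally have *: "exp (- a k * (\<epsilon> / 2 + x\<^sup>2 + \<bar>x\<bar> * h)) * ?q \<le> ?P" .
      have "exp (- (x\<^sup>2 / 2 + \<epsilon>) * a k) \<le> exp (a k * - (\<epsilon> / 2 + x\<^sup>2 / 2 + (\<bar>x\<bar> * h + h\<^sup>2 / 8)))"
      proof -
        have "a k * - (x\<^sup>2 / 2 + \<epsilon>) \<le> a k * - (\<epsilon> / 2 + x\<^sup>2 / 2 + (\<bar>x\<bar> * h + h\<^sup>2 / 8))"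
          using h\<epsilon> elim by (intro mult_left_mono) auto
        then show ?thesis by (simp add: mult.commute)
      qed
      also have "\<dots> = exp (- a k * (\<epsilon> / 2 + x\<^sup>2 + \<bar>x\<bar> * h)) * ?q"
        by (simp add: algebra_simps flip: exp_add)
      also note *
      also have "?P \<le> prob {\<omega> \<in> space M. \<bar>Y k \<omega> - x\<bar> < \<eta>}"
        using h by (intro finite_measure_mono) auto
      finally show ?case .
    qed
  qed
  show ?thesis
    unfolding satisfies_LDP_def
  proof (intro conjI allI impI)
    fix L :: real
    have "{x. ereal (x\<^sup>2 / 2) \<le> ereal L} = {x. x\<^sup>2 \<le> 2 * L}" by auto
    moreover have "closed {x::real. x\<^sup>2 \<le> 2 * L}" by (intro closed_Collect_le continuous_intros)
    moreover have "bounded {x::real. x\<^sup>2 \<le> 2 * L}"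
    proof (rule boundedI)
      fix x :: real assume "x \<in> {x. x\<^sup>2 \<le> 2 * L}"
      then show "norm x \<le> sqrt (2 * L)" using real_sqrt_le_mono[of "x\<^sup>2" "2 * L"] by simp
    qed
    ultimately show "compact {x. ereal (x\<^sup>2 / 2) \<le> ereal L}" by (simp add: compact_eq_bounded_closed)
  next
    fix G :: "real set" assume "open G"
    show "- (INF x\<in>G. ereal (x\<^sup>2 / 2)) \<le> liminf (\<lambda>k. ereal (1 / a k) * ln_ennreal (emeasure M {\<omega> \<in> space M. Y k \<omega> \<in> G}))"
    \<comment> \<open>With the signs exchanged, the claim bounds an infimum from below and can be
      checked at single points of \<open>G\<close>; an empty \<open>G\<close> is covered as
      well.\<close>
    proof (subst ereal_uminus_le_reorder, rule INF_greatest)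
      fix x assume "x \<in> G"
      with \<open>open G\<close> obtain \<eta> where \<eta>: "\<eta> > 0" "\<And>y. \<bar>y - x\<bar> < \<eta> \<Longrightarrow> y \<in> G"
        by (metis open_real)
      have "ereal (- (x\<^sup>2 / 2)) \<le> liminf (\<lambda>k. ereal (1 / a k) * ln_ennreal (emeasure M {\<omega> \<in> space M. Y k \<omega> \<in> G}))"
      proof (rule ereal_le_epsilon2)
        fix \<epsilon> :: real assume "\<epsilon> > 0"
        have "\<forall>\<^sub>F k in sequentially. ereal (- (x\<^sup>2 / 2 + \<epsilon>)) \<le> ereal (1 / a k) * ln_ennreal (emeasure M {\<omega> \<in> space M. Y k \<omega> \<in> G})"
          using lower[OF \<eta>(1) \<open>\<epsilon> > 0\<close>, of x] a_pos
        proof eventually_elim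
          case (elim k)
          have [measurable]: "Y k \<in> borel_measurable M" "G \<in> sets borel" using elim meas \<open>open G\<close> by auto
          have "prob {\<omega> \<in> space M. \<bar>Y k \<omega> - x\<bar> < \<eta>} \<le> prob {\<omega> \<in> space M. Y k \<omega> \<in> G}"
            using \<eta>(2) by (intro finite_measure_mono) auto
          with elim show ?case
            unfolding emeasure_eq_measure by (subst le_scaled_ln_ennreal_iff) auto
        qed
        then have "ereal (- (x\<^sup>2 / 2 + \<epsilon>)) \<le> liminf (\<lambda>k. ereal (1 / a k) * ln_ennreal (emeasure M {\<omega> \<in> space M. Y k \<omega> \<in> G}))"
          by (rule Liminf_bounded)
        then show "ereal (- (x\<^sup>2 / 2)) \<le> liminf (\<lambda>k. ereal (1 / a k) * ln_ennreal (emeasure M {\<omega> \<in> space M. Y k \<omega> \<in> G})) + ereal \<epsilon>"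
          using add_right_mono[of "ereal (- (x\<^sup>2 / 2 + \<epsilon>))" _ "ereal \<epsilon>"] by simp
      qed
      then show "- liminf (\<lambda>k. ereal (1 / a k) * ln_ennreal (emeasure M {\<omega> \<in> space M. Y k \<omega> \<in> G})) \<le> ereal (x\<^sup>2 / 2)"
        by (subst ereal_uminus_le_reorder) simp
    qed
  next
    fix A :: "real set" assume "closed A"
    let ?L = "limsup (\<lambda>k. ereal (1 / a k) * ln_ennreal (emeasure M {\<omega> \<in> space M. Y k \<omega> \<in> A}))"
    \<comment> \<open>Comparing with real \<open>c\<close> below the infimum also handles the value
      \<open>\<infinity>\<close> for empty \<open>A\<close>. For \<open>c \<le> 0\<close> the bound
      by probability 1 suffices; for \<open>c > 0\<close> the set \<open>A\<close> avoids the open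
      interval of radius \<open>sqrt (2 * c)\<close> around 0, and the two-sided tail bound
      applies.\<close>
    have "ereal c \<le> - ?L" if c: "ereal c < (INF x\<in>A. ereal (x\<^sup>2 / 2))" for c
    proof (cases "c \<le> 0")
      case True
      have "\<forall>\<^sub>F k in sequentially. ereal (1 / a k) * ln_ennreal (emeasure M {\<omega> \<in> space M. Y k \<omega> \<in> A}) \<le> ereal (- c)"
        using a_pos
      proof eventually_elim
        case (elim k)
        have "prob {\<omega> \<in> space M. Y k \<omega> \<in> A} \<le> 1" by simp
        also have "1 \<le> exp (- c * a k)" using elim True by (simp add: mult_nonpos_nonneg)
        finally show ?case
          unfolding emeasure_eq_measure using elim by (subst scaled_ln_ennreal_le_iff) auto
      qed
      then have "?L \<le> ereal (- c)" by (rule Limsup_bounded)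
      then show ?thesis using ereal_minus_le_minus[of "ereal (- c)" ?L] by simp
    next
      case False
      define r where "r = sqrt (2 * c)"
      have r: "r > 0" "r\<^sup>2 / 2 = c" using False by (auto simp: r_def)
      have A: "r \<le> \<bar>x\<bar>" if "x \<in> A" for x
      proof -
        have "ereal c < ereal (x\<^sup>2 / 2)" using c INF_lower[OF that] by (rule less_le_trans)
        then have "r\<^sup>2 \<le> \<bar>x\<bar>\<^sup>2" using r by simp
        then show ?thesis using abs_ge_zero by (rule power2_le_imp_le)
      qed
      have "?L \<le> ereal (- c)"
      proof (rule ereal_le_epsilon2)
        fix \<epsilon> :: real assume "\<epsilon> > 0"
        have "\<forall>\<^sub>F k in sequentially. ereal (1 / a k) * ln_ennreal (emeasure M {\<omega> \<in> space M. Y k \<omega> \<in> A}) \<le> ereal (- (r\<^sup>2 / 2 - \<epsilon>))"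
          using upper[OF r(1) \<open>\<epsilon> > 0\<close>] a_pos
        proof eventually_elim
          case (elim k)
          have [measurable]: "Y k \<in> borel_measurable M" using elim meas by auto
          have "prob {\<omega> \<in> space M. Y k \<omega> \<in> A} \<le> prob {\<omega> \<in> space M. r \<le> \<bar>Y k \<omega>\<bar>}"
            using A by (intro finite_measure_mono) auto
          with elim show ?case
            unfolding emeasure_eq_measure by (subst scaled_ln_ennreal_le_iff) auto
        qed
        then have "?L \<le> ereal (- (r\<^sup>2 / 2 - \<epsilon>))" by (rule Limsup_bounded)
        then show "?L \<le> ereal (- c) + ereal \<epsilon>" using r by simp
      qed
      then show ?thesis using ereal_minus_le_minus[of "ereal (- c)" ?L] by simp
    qed
    then have "\<not> - ?L < (INF x\<in>A. ereal (x\<^sup>2 / 2))"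
      by (blast dest: ereal_dense2 less_le_trans)
    then show "?L \<le> - (INF x\<in>A. ereal (x\<^sup>2 / 2))"
      using ereal_minus_le_minus[of "- ?L" "INF x\<in>A. ereal (x\<^sup>2 / 2)"]
      unfolding not_less ereal_uminus_uminus by blast
  qed (use meas a in simp_all)
qed

section \<open>Superexponential smallness from a large deviation principle of faster speed\<close>

text \<open>Positivity at each point becomes uniform through compactness: otherwise \<open>A\<close>
  would meet every level set at height \<open>1 / (n + 1)\<close>, and these nested nonempty compact
  sets would share a point where \<open>I\<close> is at most 0.\<close>

lemma rate_function_bounded_away_from_zero:
  fixes I :: "real \<Rightarrow> ereal"
  assumes level: "\<And>L::real. 0 \<le> L \<Longrightarrow> compact {x. I x \<le> ereal L}"
    and "closed A" and pos: "\<And>x. x \<in> A \<Longrightarrow> 0 < I x"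
  obtains c :: real where "c > 0" "ereal c \<le> (INF x\<in>A. I x)"
proof (rule ccontr)
  assume "\<not> thesis"
  then have "\<not> ereal c \<le> (INF x\<in>A. I x)" if "c > 0" for c
    using that \<open>\<And>c. 0 < c \<Longrightarrow> ereal c \<le> (INF x\<in>A. I x) \<Longrightarrow> thesis\<close> by blast
  then have *: "\<exists>x\<in>A. I x < ereal c" if "c > 0" for c
    using that by (meson INF_greatest not_le)
  define K where "K n = A \<inter> {x. I x \<le> ereal (1 / real (Suc n))}" for n
  have "\<Inter>(range K) \<noteq> {}"
  proof (rule compact_nest)
    show "compact (K n)" for n
      unfolding K_def by (intro closed_Int_compact level \<open>closed A\<close>) simp
    show "K n \<noteq> {}" for n
      using *[of "1 / real (Suc n)"] by (auto simp: K_def less_imp_le)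
    show "K n \<subseteq> K m" if "m \<le> n" for m n
    proof -
      have "ereal (1 / real (Suc n)) \<le> ereal (1 / real (Suc m))"
        using that by (simp add: frac_le)
      then show ?thesis unfolding K_def by (auto intro: order_trans)
    qed
  qed
  then obtain x where x: "x \<in> A" "\<And>n. I x \<le> ereal (1 / real (Suc n))"
    by (auto simp: K_def)
  have "(\<lambda>n. ereal (1 / real (Suc n))) \<longlonglongrightarrow> ereal 0"
    using LIMSEQ_inverse_real_of_nat by (simp add: inverse_eq_divide)
  then have "I x \<le> ereal 0"
    by (rule LIMSEQ_le_const) (use x(2) in blast)
  then show False using pos[OF x(1)] by (simp add: zero_ereal_def[symmetric])
qed

text \<open>The rate is at least some \<open>c > 0\<close> on \<open>A\<close>, so the probability
  is eventually at most \<open>exp (- (c / 2) * v k)\<close>; halving \<open>c\<close> gives room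
  for the limsup. As \<open>a k\<close> is negligible against \<open>v k\<close>, this beats
  \<open>exp (- R * a k)\<close> for every \<open>R\<close>.\<close>

lemma (in prob_space) LDP_tail_superexponential:
  assumes LDP: "satisfies_LDP M Y v I"
    and "closed A" and pos: "\<And>x. x \<in> A \<Longrightarrow> 0 < I x"
    and av: "(\<lambda>k. a k / v k) \<longlonglongrightarrow> 0"
  shows "\<forall>\<^sub>F k in sequentially. prob {\<omega> \<in> space M. Y k \<omega> \<in> A} \<le> exp (- R * a k)"
proof -
  obtain c :: real where c: "c > 0" "ereal c \<le> (INF x\<in>A. I x)"
    using LDP \<open>closed A\<close> pos unfolding satisfies_LDP_def by (metis rate_function_bounded_away_from_zero)
  let ?f = "\<lambda>k. ereal (1 / v k) * ln_ennreal (emeasure M {\<omega> \<in> space M. Y k \<omega> \<in> A})"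
  have "limsup ?f \<le> - (INF x\<in>A. I x)"
    using LDP \<open>closed A\<close> by (simp add: satisfies_LDP_def)
  also have "\<dots> \<le> - ereal c" using c(2) by (simp only: ereal_minus_le_minus)
  also have "\<dots> < ereal (- (c / 2))" using c(1) by simp
  finally have "\<forall>\<^sub>F k in sequentially. ?f k < ereal (- (c / 2))" by (rule Limsup_lessD)
  moreover have "\<forall>\<^sub>F k in sequentially. 0 < v k"
    using LDP by (auto simp: satisfies_LDP_def filterlim_at_top_dense)
  moreover have "\<forall>\<^sub>F k in sequentially. R * (a k / v k) < c / 2"
    using tendsto_mult_right_zero[OF av, of R] c(1) by (intro order_tendstoD(2)) auto
  ultimately show ?thesis
  proof eventually_elim
    case (elim k)
    have "prob {\<omega> \<in> space M. Y k \<omega> \<in> A} \<le> exp (- (c / 2) * v k)"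
      using elim scaled_ln_ennreal_le_iff[of "v k" "prob {\<omega> \<in> space M. Y k \<omega> \<in> A}" "- (c / 2)"]
      by (simp add: emeasure_eq_measure less_imp_le)
    also have "\<dots> \<le> exp (- R * a k)"
      using elim by (simp add: field_simps)
    finally show ?case .
  qed
qed

section \<open>Uniform estimates for the truncated random sum\<close>

lemma filterlim_powr_at_top:
  assumes "filterlim f at_top F" "(s::real) > 0"
  shows "filterlim (\<lambda>x. f x powr s) at_top F"
proof -
  have "filterlim (\<lambda>x. exp (s * ln (f x))) at_top F"
    using assms
    by (intro filterlim_compose[OF exp_at_top] filterlim_tendsto_pos_mult_at_top[OF tendsto_const]
        filterlim_compose[OF ln_at_top])
  moreover have "\<forall>\<^sub>F x in F. f x > 0"
    using assms(1) by (auto simp: filterlim_at_top_dense)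
  ultimately show ?thesis
    by (subst filterlim_cong[OF refl refl, where g = "\<lambda>x. exp (s * ln (f x))"])
      (auto elim: eventually_mono simp: powr_def)
qed

text \<open>The truncated transform is a sum over \<open>B\<close> of powers weighted by
  \<open>prob (N = n)\<close>. Bounds common to all these powers factor out and leave the total
  weight \<open>prob E\<close>.\<close>

lemma (in prob_space) mgf_random_sum_bounds:
  fixes X :: "nat \<Rightarrow> 'a \<Rightarrow> real" and N :: "'a \<Rightarrow> nat"
  assumes X_indep: "indep_vars (\<lambda>_. borel) X {1..}"
    and ident: "\<And>i. i \<ge> 1 \<Longrightarrow> distr M borel (X i) = distr M borel (X 1)"
    and int: "integrable M (\<lambda>\<omega>. exp (t * X 1 \<omega>))"
    and N_indep: "indep_random_elements M (count_space UNIV) N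
            (PiM {1..} (\<lambda>_. borel)) (\<lambda>\<omega>. \<lambda>i\<in>{1..}. X i \<omega>)"
    and "finite B"
    and bounds: "\<And>n. n \<in> B \<Longrightarrow> expectation (\<lambda>\<omega>. exp (t * X 1 \<omega>)) ^ n \<in> {l..u}"
  defines "E \<equiv> {\<omega> \<in> space M. N \<omega> \<in> B}"
  shows "integrable M (\<lambda>\<omega>. indicator E \<omega> * exp (t * (\<Sum>i=1..N \<omega>. X i \<omega>)))"
    and "expectation (\<lambda>\<omega>. indicator E \<omega> * exp (t * (\<Sum>i=1..N \<omega>. X i \<omega>))) \<in> {prob E * l .. prob E * u}"
proof -
  have [measurable]: "N \<in> measurable M (count_space UNIV)"
    using N_indep by (simp add: indep_random_elements_def)
  have ind: "indicator E \<omega> = (indicator {\<omega>. N \<omega> \<in> B} \<omega> :: real)" if "\<omega> \<in> space M" for \<omega>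
    using that by (auto simp: E_def indicator_def)
  have E: "prob E = (\<Sum>n\<in>B. prob {\<omega> \<in> space M. N \<omega> = n})"
  proof -
    have "E = (\<Union>n\<in>B. {\<omega> \<in> space M. N \<omega> = n})" by (auto simp: E_def)
    then show ?thesis
      using \<open>finite B\<close> by (simp only:) (intro finite_measure_finite_Union, auto simp: disjoint_family_on_def)
  qed
  show "integrable M (\<lambda>\<omega>. indicator E \<omega> * exp (t * (\<Sum>i=1..N \<omega>. X i \<omega>)))"
  proof (subst Bochner_Integration.integrable_cong[OF refl])
    show "integrable M (\<lambda>\<omega>. indicator {\<omega>. N \<omega> \<in> B} \<omega> * exp (t * (\<Sum>i=1..N \<omega>. X i \<omega>)))"
      by (intro mgf_random_sum(1) X_indep ident int N_indep \<open>finite B\<close>; assumption)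
  qed (simp only: ind)
  have "expectation (\<lambda>\<omega>. indicator E \<omega> * exp (t * (\<Sum>i=1..N \<omega>. X i \<omega>)))
      = expectation (\<lambda>\<omega>. indicator {\<omega>. N \<omega> \<in> B} \<omega> * exp (t * (\<Sum>i=1..N \<omega>. X i \<omega>)))"
    by (intro Bochner_Integration.integral_cong) (simp_all only: ind)
  also have "\<dots> = (\<Sum>n\<in>B. prob {\<omega> \<in> space M. N \<omega> = n} * expectation (\<lambda>\<omega>. exp (t * X 1 \<omega>)) ^ n)"
    by (intro mgf_random_sum(2) X_indep ident int N_indep \<open>finite B\<close>; assumption)
  also have "\<dots> \<in> {prob E * l .. prob E * u}"
    using bounds unfolding E sum_distrib_right by (auto intro!: sum_mono mult_left_mono)
  finally show "expectation (\<lambda>\<omega>. indicator E \<omega> * exp (t * (\<Sum>i=1..N \<omega>. X i \<omega>))) \<in> {prob E * l .. prob E * u}" .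
qed

text \<open>Meant for \<open>s = t\<^sup>2\<close>, a length \<open>n\<close> close to its mean
  \<open>\<mu>\<close>, and \<open>e\<close> the relative error in the transform of one summand. Per
  unit of \<open>a\<close>, the exponent differs from \<open>\<theta>\<^sup>2 / 2\<close> by at most
  \<open>\<theta>\<^sup>2 * (d / 2 + e + d * e)\<close>, hence by less than or equal to
  \<open>3 * \<theta>\<^sup>2 * d\<close>; this explains the 6 in \<open>small\<close>. The bound
  \<open>d \<le> 1 / 2\<close> keeps \<open>1 / 2 - e\<close> nonnegative.\<close>

lemma quadratic_exponent_bounds:
  fixes s \<mu> a \<theta> d e :: real
  assumes "\<bar>n - \<mu>\<bar> \<le> d * \<mu>" "s * \<mu> = \<theta>\<^sup>2 * a" "0 \<le> s" "0 < \<mu>" "0 \<le> a" "0 \<le> e" "e \<le> d" "d \<le> 1 / 2"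
    and small: "6 * (\<theta>\<^sup>2 * d) \<le> \<delta>"
  shows "a * (\<theta>\<^sup>2 / 2 - \<delta> / 2) \<le> n * (s * (1 / 2 - e))"
    and "n * (s * (1 / 2 + e)) \<le> a * (\<theta>\<^sup>2 / 2 + \<delta> / 2)"
proof -
  have n: "(1 - d) * \<mu> \<le> n" "n \<le> (1 + d) * \<mu>"
    using assms(1) by (auto simp: abs_le_iff algebra_simps)
  have e\<theta>: "\<theta>\<^sup>2 * e \<le> \<theta>\<^sup>2 * d" "0 \<le> \<theta>\<^sup>2 * e"
    using assms by (auto intro: mult_left_mono)
  have de: "0 \<le> d * (\<theta>\<^sup>2 * e)" "d * (\<theta>\<^sup>2 * e) \<le> 1 * (\<theta>\<^sup>2 * e)"
    using assms e\<theta> by (intro mult_nonneg_nonneg mult_right_mono; simp)+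
  have "\<theta>\<^sup>2 * ((1 - d) * (1 / 2 - e)) = \<theta>\<^sup>2 / 2 - \<theta>\<^sup>2 * d / 2 - \<theta>\<^sup>2 * e + d * (\<theta>\<^sup>2 * e)"
    by (simp add: field_simps)
  then have "\<theta>\<^sup>2 / 2 - \<delta> / 2 \<le> \<theta>\<^sup>2 * ((1 - d) * (1 / 2 - e))"
    using small e\<theta> de by linarith
  then have "a * (\<theta>\<^sup>2 / 2 - \<delta> / 2) \<le> a * (\<theta>\<^sup>2 * ((1 - d) * (1 / 2 - e)))"
    using \<open>0 \<le> a\<close> by (rule mult_left_mono)
  also have "\<dots> = (1 - d) * \<mu> * (s * (1 / 2 - e))"
    using assms(2) by (simp add: mult_ac)
  also have "\<dots> \<le> n * (s * (1 / 2 - e))"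
    using n assms by (intro mult_right_mono) auto
  finally show "a * (\<theta>\<^sup>2 / 2 - \<delta> / 2) \<le> n * (s * (1 / 2 - e))" .
  have "\<theta>\<^sup>2 * ((1 + d) * (1 / 2 + e)) = \<theta>\<^sup>2 / 2 + \<theta>\<^sup>2 * d / 2 + \<theta>\<^sup>2 * e + d * (\<theta>\<^sup>2 * e)"
    by (simp add: field_simps)
  then have upper: "\<theta>\<^sup>2 * ((1 + d) * (1 / 2 + e)) \<le> \<theta>\<^sup>2 / 2 + \<delta> / 2"
    using small e\<theta> de by linarith
  have "n * (s * (1 / 2 + e)) \<le> (1 + d) * \<mu> * (s * (1 / 2 + e))"
    using n assms by (intro mult_right_mono) auto
  also have "\<dots> = a * (\<theta>\<^sup>2 * ((1 + d) * (1 / 2 + e)))"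
    using assms(2) by (simp add: mult_ac)
  also have "\<dots> \<le> a * (\<theta>\<^sup>2 / 2 + \<delta> / 2)"
    using upper \<open>0 \<le> a\<close> by (rule mult_left_mono)
  finally show "n * (s * (1 / 2 + e)) \<le> a * (\<theta>\<^sup>2 / 2 + \<delta> / 2)" .
qed

section \<open>Moderate deviations: truncating the random length and verifying the transform
  criterion\<close>

theorem theorem3p4:
  fixes M :: "'a measure"
    and X :: "nat \<Rightarrow> 'a \<Rightarrow> real"
    and \<nu> :: "nat \<Rightarrow> 'a \<Rightarrow> nat"
    and \<mu> :: "nat \<Rightarrow> real"
    and D \<alpha> \<beta> :: real
    and I :: "real \<Rightarrow> ereal"
  assumes "prob_space M"
    and X_indep: "prob_space.indep_vars M (\<lambda>_. borel) X {1..}"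
    and X_ident: "\<And>i. i \<ge> 1 \<Longrightarrow> distr M borel (X i) = distr M borel (X 1)"
    and X_integrable: "integrable M (X 1)"
    and X_mean: "prob_space.expectation M (X 1) = 0"
    and X_variance: "prob_space.variance M (X 1) = 1"
    and D_pos: "D > 0"
    and X_mgf: "\<And>t. t \<in> {-D<..<D} \<Longrightarrow>
          ln_ennreal (\<integral>\<^sup>+\<omega>. ennreal (exp (t * X 1 \<omega>)) \<partial>M) < \<infinity>"
    and \<nu>_measurable: "\<And>k. k \<ge> 1 \<Longrightarrow> \<nu> k \<in> measurable M (count_space UNIV)"
    and \<nu>_pos: "\<And>k \<omega>. k \<ge> 1 \<Longrightarrow> \<omega> \<in> space M \<Longrightarrow> \<nu> k \<omega> \<ge> 1"
    and \<nu>_indep: "\<And>k. k \<ge> 1 \<Longrightarrow>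
          indep_random_elements M (count_space UNIV) (\<nu> k)
            (PiM {1..} (\<lambda>_. borel)) (\<lambda>\<omega>. \<lambda>i\<in>{1..}. X i \<omega>)"
    and \<nu>_integrable: "\<And>k. k \<ge> 1 \<Longrightarrow> integrable M (\<lambda>\<omega>. real (\<nu> k \<omega>))"
    and \<mu>_def: "\<And>k. k \<ge> 1 \<Longrightarrow> \<mu> k = prob_space.expectation M (\<lambda>\<omega>. real (\<nu> k \<omega>))"
    and \<mu>_lim: "filterlim \<mu> at_top sequentially"
    and \<nu>_lim: "diverges_in_prob M (\<lambda>k \<omega>. real (\<nu> k \<omega>))"
    and ratio_lim: "converges_in_prob M (\<lambda>k \<omega>. real (\<nu> k \<omega>) / \<mu> k) 1"
    and \<alpha>: "0 < \<alpha>" "\<alpha> < 1/2"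
    and \<beta>: "\<beta> > 2 * \<alpha>"
    and LDP: "satisfies_LDP M (\<lambda>k \<omega>. real (\<nu> k \<omega>) / \<mu> k) (\<lambda>k. \<mu> k powr \<beta>) I"
    and I_min: "I 1 = 0" "\<And>x. x \<noteq> 1 \<Longrightarrow> I x > 0"
  shows "satisfies_LDP M
           (\<lambda>k \<omega>. (1 / \<mu> k powr (1/2 + \<alpha>)) * (\<Sum>i=1..\<nu> k \<omega>. X i \<omega>))
           (\<lambda>k. \<mu> k powr (2 * \<alpha>))
           (\<lambda>x. ereal (x\<^sup>2 / 2))"
proof -
  interpret prob_space M by fact
  have X_meas: "X i \<in> borel_measurable M" if "i \<ge> 1" for i
    using X_indep that by (auto simp: indep_vars_def)
  have \<mu>_pos: "\<forall>\<^sub>F k in sequentially. 1 \<le> k \<and> 0 < \<mu> k"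
    using \<mu>_lim by (auto simp: filterlim_at_top_dense eventually_conj_iff eventually_ge_at_top)
  have X_sq: "expectation (\<lambda>\<omega>. (X 1 \<omega>)\<^sup>2) = 1"
    using X_variance X_mean by simp
  \<comment> \<open>The Bochner integral of a nonintegrable function is 0 by convention, so the
    value 1 forces integrability.\<close>
  then have X_sq_int: "integrable M (\<lambda>\<omega>. (X 1 \<omega>)\<^sup>2)"
    using not_integrable_integral_eq by fastforce
  have X_exp_int: "integrable M (\<lambda>\<omega>. exp (t * X 1 \<omega>))" if "\<bar>t\<bar> < D" for t
  proof (rule integrableI_nonneg)
    have "ln_ennreal (\<integral>\<^sup>+\<omega>. ennreal (exp (t * X 1 \<omega>)) \<partial>M) < \<infinity>"
      using that by (intro X_mgf) auto
    then show "(\<integral>\<^sup>+\<omega>. ennreal (exp (t * X 1 \<omega>)) \<partial>M) < \<infinity>"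
      by (auto simp: ln_ennreal_def less_top split: if_splits)
  qed (use X_meas[of 1] in auto)
  obtain r C where rC: "0 < r" "r < D" "0 \<le> C"
    "\<And>t. \<bar>t\<bar> \<le> r \<Longrightarrow> expectation (\<lambda>\<omega>. exp (t * X 1 \<omega>)) \<in> {exp (t\<^sup>2 * (1 / 2 - C * \<bar>t\<bar>)) .. exp (t\<^sup>2 * (1 / 2 + C * \<bar>t\<bar>))}"
    using standardized_mgf_bounds[OF D_pos X_exp_int X_integrable X_sq_int X_mean X_sq] by blast
  define a where "a k = \<mu> k powr (2 * \<alpha>)" for k
  have a_lim: "filterlim a at_top sequentially"
    unfolding a_def using \<mu>_lim \<alpha> by (intro filterlim_powr_at_top) auto
  \<comment> \<open>Here \<open>\<beta> > 2 * \<alpha>\<close> enters: fluctuations of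
    \<open>\<nu> k / \<mu> k\<close> away from 1 are negligible at speed \<open>a k\<close>.\<close>
  have a_v: "(\<lambda>k. a k / \<mu> k powr \<beta>) \<longlonglongrightarrow> 0"
    using tendsto_neg_powr[OF _ \<mu>_lim, of "2 * \<alpha> - \<beta>"] \<beta> by (simp add: a_def powr_diff)
  let ?Z = "\<lambda>k \<omega>. (1 / \<mu> k powr (1/2 + \<alpha>)) * (\<Sum>i=1..\<nu> k \<omega>. X i \<omega>)"
  have "satisfies_LDP M ?Z a (\<lambda>x. ereal (x\<^sup>2 / 2))"
  proof (rule LDP_Gaussian_rate_if_truncated_mgf[OF _ a_lim])
    show "?Z k \<in> borel_measurable M" if "k \<ge> 1" for k
    proof (intro borel_measurable_times borel_measurable_const)
      show "(\<lambda>\<omega>. \<Sum>i=1..\<nu> k \<omega>. X i \<omega>) \<in> borel_measurable M"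
        by (rule measurable_compose_countable[OF _ \<nu>_measurable[OF that], of "\<lambda>n \<omega>. \<Sum>i=1..n. X i \<omega>"])
          (auto intro!: borel_measurable_sum X_meas)
    qed
    fix B \<delta> :: real
    assume "\<delta> > 0"
    \<comment> \<open>Chosen so that \<open>6 * (\<theta>\<^sup>2 * d) \<le> \<delta>\<close> for
      all \<open>\<bar>\<theta>\<bar> \<le> B\<close> at once; the \<open>+ 1\<close> keeps the
      denominator positive when \<open>B = 0\<close>.\<close>
    define d where "d = min (1 / 2) (\<delta> / (6 * (B\<^sup>2 + 1)))"
    have B1: "6 * (B\<^sup>2 + 1) > 0" by (simp add: add_nonneg_pos)
    have d: "0 < d" "d \<le> 1 / 2" "d \<le> \<delta> / (6 * (B\<^sup>2 + 1))"
      using divide_pos_pos[OF \<open>\<delta> > 0\<close> B1] unfolding d_def by (simp_all only: min_less_iff_conj min.cobounded1 min.cobounded2, simp)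
    have d\<delta>: "6 * ((B\<^sup>2 + 1) * d) \<le> \<delta>"
      using d(3) B1 by (simp add: pos_le_divide_eq mult_ac)
    define Nk where "Nk k = {n. \<bar>real n / \<mu> k - 1\<bar> < d}" for k
    define E where "E k = {\<omega> \<in> space M. \<nu> k \<omega> \<in> Nk k}" for k
    have E: "E k \<in> events" if "k \<ge> 1" for k
      unfolding E_def using \<nu>_measurable[OF that] by measurable
    have E_tail: "\<forall>\<^sub>F k in sequentially. prob (space M - E k) \<le> exp (- R * a k)" for R
    proof -
      \<comment> \<open>The complement of \<open>E k\<close> is the event that the ratio lies in
        this closed set, which excludes 1, so that \<open>I\<close> is positive on it.\<close>
      have cl: "closed {x::real. d \<le> \<bar>x - 1\<bar>}"
        by (intro closed_Collect_le continuous_intros)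
      have "\<forall>\<^sub>F k in sequentially.
          prob {\<omega> \<in> space M. real (\<nu> k \<omega>) / \<mu> k \<in> {x. d \<le> \<bar>x - 1\<bar>}} \<le> exp (- R * a k)"
        using d(1) by (intro LDP_tail_superexponential[OF LDP cl _ a_v] I_min(2)) auto
      moreover have "{\<omega> \<in> space M. real (\<nu> k \<omega>) / \<mu> k \<in> {x. d \<le> \<bar>x - 1\<bar>}} = space M - E k" for k
        by (auto simp: E_def Nk_def)
      ultimately show ?thesis by simp
    qed
    have E_mgf: "\<forall>\<^sub>F k in sequentially.
        integrable M (\<lambda>\<omega>. indicator (E k) \<omega> * exp (\<theta> * a k * ?Z k \<omega>)) \<and>
        expectation (\<lambda>\<omega>. indicator (E k) \<omega> * exp (\<theta> * a k * ?Z k \<omega>))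
          \<in> {exp (a k * (\<theta>\<^sup>2 / 2 - \<delta>)) .. exp (a k * (\<theta>\<^sup>2 / 2 + \<delta>))}" if "\<bar>\<theta>\<bar> \<le> B" for \<theta>
    proof -
      \<comment> \<open>This is the coefficient of the unscaled sum in
        \<open>\<theta> * a k * ?Z k \<omega>\<close>. It tends to 0 because
        \<open>\<alpha> < 1/2\<close>, so eventually the expansion of the moment generating function
        applies with relative error \<open>C * \<bar>t k\<bar> < d\<close>.\<close>
      define t where "t k = \<theta> * \<mu> k powr (\<alpha> - 1/2)" for k
      have t_lim: "t \<longlonglongrightarrow> 0"
        unfolding t_def using \<alpha> \<mu>_lim by (intro tendsto_mult_right_zero tendsto_neg_powr) auto
      have "(\<lambda>k. C * \<bar>t k\<bar>) \<longlonglongrightarrow> 0"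
        using tendsto_mult_right_zero[OF tendsto_rabs_zero[OF t_lim]] .
      then have ev_C: "\<forall>\<^sub>F k in sequentially. C * \<bar>t k\<bar> < d"
        using d(1) by (rule order_tendstoD)
      have ev_r: "\<forall>\<^sub>F k in sequentially. \<bar>t k\<bar> < r"
        using tendsto_rabs_zero[OF t_lim] rC(1) by (rule order_tendstoD)
      have "\<delta> / 2 > 0" using \<open>\<delta> > 0\<close> by simp
      from \<mu>_pos ev_C ev_r E_tail[of 1] eventually_const_le_exp[OF a_lim zero_less_one, of 2]
        eventually_const_le_exp[OF a_lim this, of 2]
      show ?thesis
      proof eventually_elim
        case (elim k)
        let ?phi = "expectation (\<lambda>\<omega>. exp (t k * X 1 \<omega>))"
        let ?l = "exp (a k * (\<theta>\<^sup>2 / 2 - \<delta> / 2))" and ?u = "exp (a k * (\<theta>\<^sup>2 / 2 + \<delta> / 2))"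
        have \<mu>: "\<mu> k > 0" using elim by simp
        have t2: "(t k)\<^sup>2 * \<mu> k = \<theta>\<^sup>2 * a k"
        proof -
          have "(t k)\<^sup>2 * \<mu> k = \<theta>\<^sup>2 * (\<mu> k powr (\<alpha> - 1/2) * \<mu> k powr (\<alpha> - 1/2) * \<mu> k powr 1)"
            using \<mu> by (simp add: t_def power2_eq_square)
          also have "\<dots> = \<theta>\<^sup>2 * a k"
            unfolding a_def powr_add[symmetric] by (simp add: algebra_simps)
          finally show ?thesis .
        qed
        have tZ: "\<theta> * a k * ?Z k \<omega> = t k * (\<Sum>i=1..\<nu> k \<omega>. X i \<omega>)" for \<omega>
        proof -
          have "a k / \<mu> k powr (1/2 + \<alpha>) = \<mu> k powr (\<alpha> - 1/2)"
            unfolding a_def powr_diff[symmetric] by (simp add: algebra_simps)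
          then have "\<theta> * (a k / \<mu> k powr (1/2 + \<alpha>)) * (\<Sum>i=1..\<nu> k \<omega>. X i \<omega>) = t k * (\<Sum>i=1..\<nu> k \<omega>. X i \<omega>)"
            by (simp only: t_def)
          then show ?thesis by simp
        qed
        \<comment> \<open>On the truncation event the length is below \<open>2 * \<mu> k\<close>;
          this finiteness permits conditioning on \<open>\<nu> k\<close> term by term.\<close>
        have fin: "finite (Nk k)"
        proof (rule finite_subset)
          show "Nk k \<subseteq> {..nat \<lceil>2 * \<mu> k\<rceil>}"
          proof
            fix n assume "n \<in> Nk k"
            then have "real n / \<mu> k < 2" using d by (auto simp: Nk_def)
            then have "real n < 2 * \<mu> k" using \<mu> by (simp add: field_simps)
            then show "n \<in> {..nat \<lceil>2 * \<mu> k\<rceil>}" by simp linarith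
          qed
        qed simp
        have bounds: "?phi ^ n \<in> {?l..?u}" if "n \<in> Nk k" for n
        proof -
          have "\<bar>real n / \<mu> k - 1\<bar> * \<mu> k \<le> d * \<mu> k"
            using that \<mu> by (intro mult_right_mono) (auto simp: Nk_def)
          moreover have "\<bar>real n / \<mu> k - 1\<bar> * \<mu> k = \<bar>real n - \<mu> k\<bar>"
          proof -
            have "real n - \<mu> k = (real n / \<mu> k - 1) * \<mu> k" using \<mu> by (simp add: field_simps)
            then show ?thesis using \<mu> by (simp only: abs_mult abs_of_pos)
          qed
          ultimately have n: "\<bar>real n - \<mu> k\<bar> \<le> d * \<mu> k" by simp
          have "\<theta>\<^sup>2 \<le> B\<^sup>2" using power_mono[OF \<open>\<bar>\<theta>\<bar> \<le> B\<close>, of 2] by simp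
          then have "\<theta>\<^sup>2 * d \<le> (B\<^sup>2 + 1) * d" using d(1) by (intro mult_right_mono) auto
          then have small: "6 * (\<theta>\<^sup>2 * d) \<le> \<delta>" using d\<delta> by linarith
          note exponent = quadratic_exponent_bounds[OF n t2 _ \<mu> _ _ _ d(2) small, of "C * \<bar>t k\<bar>"]
          have phi: "?phi \<in> {exp ((t k)\<^sup>2 * (1 / 2 - C * \<bar>t k\<bar>)) .. exp ((t k)\<^sup>2 * (1 / 2 + C * \<bar>t k\<bar>))}"
            using elim by (intro rC(4)) auto
          have "?l \<le> exp ((t k)\<^sup>2 * (1 / 2 - C * \<bar>t k\<bar>)) ^ n"
            using exponent(1) elim rC(3) by (simp add: a_def flip: exp_of_nat_mult)
          also have "\<dots> \<le> ?phi ^ n" using phi by (intro power_mono) auto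
          finally have "?l \<le> ?phi ^ n" .
          moreover have "?phi ^ n \<le> exp ((t k)\<^sup>2 * (1 / 2 + C * \<bar>t k\<bar>)) ^ n"
            using phi by (intro power_mono) (auto intro: order_trans[OF exp_ge_zero])
          moreover have "\<dots> \<le> ?u"
            using exponent(2) elim rC(3) by (simp add: a_def flip: exp_of_nat_mult)
          ultimately show ?thesis by auto
        qed
        have int_t: "integrable M (\<lambda>\<omega>. exp (t k * X 1 \<omega>))"
          using elim rC by (intro X_exp_int) auto
        have W: "integrable M (\<lambda>\<omega>. indicator (E k) \<omega> * exp (\<theta> * a k * ?Z k \<omega>))"
          "expectation (\<lambda>\<omega>. indicator (E k) \<omega> * exp (\<theta> * a k * ?Z k \<omega>)) \<in> {prob (E k) * ?l .. prob (E k) * ?u}"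
          unfolding E_def tZ using elim
          by (intro mgf_random_sum_bounds[where l = ?l and u = ?u] X_indep X_ident int_t \<nu>_indep fin bounds; simp)+
        \<comment> \<open>The tail bound with \<open>R = 1\<close> gives \<open>prob (E k)\<close>
          at least one half. The lower transform bound loses this factor, and the part
          \<open>\<delta> / 2\<close> left over by the exponent estimate absorbs it.\<close>
        have "exp (- 1 * a k) \<le> 1 / 2"
          using elim by (simp add: exp_minus field_simps)
        then have E_half: "1 / 2 \<le> prob (E k)"
          using elim E[of k] by (simp add: prob_compl)
        have "exp (a k * (\<theta>\<^sup>2 / 2 - \<delta>)) = exp (- (a k * (\<delta> / 2))) * ?l"
          by (simp add: algebra_simps flip: exp_add)
        also have "\<dots> \<le> prob (E k) * ?l"
        proof (intro mult_right_mono)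
          have "exp (- (a k * (\<delta> / 2))) \<le> 1 / 2"
            using elim by (simp add: exp_minus field_simps)
          then show "exp (- (a k * (\<delta> / 2))) \<le> prob (E k)" using E_half by simp
        qed simp
        finally have low: "exp (a k * (\<theta>\<^sup>2 / 2 - \<delta>)) \<le> prob (E k) * ?l" .
        have "prob (E k) * ?u \<le> 1 * exp (a k * (\<theta>\<^sup>2 / 2 + \<delta>))"
          using \<open>\<delta> > 0\<close> by (intro mult_mono) (auto simp: a_def intro!: mult_left_mono)
        then show ?case
          using W low by (simp only: atLeastAtMost_iff simp_thms) (intro conjI; linarith)
      qed
    qed
    show "\<exists>E. (\<forall>k. k \<ge> 1 \<longrightarrow> E k \<in> events) \<and>
      (\<forall>R. \<forall>\<^sub>F k in sequentially. prob (space M - E k) \<le> exp (- R * a k)) \<and>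
      (\<forall>\<theta>. \<bar>\<theta>\<bar> \<le> B \<longrightarrow> (\<forall>\<^sub>F k in sequentially.
        integrable M (\<lambda>\<omega>. indicator (E k) \<omega> * exp (\<theta> * a k * ?Z k \<omega>)) \<and>
        expectation (\<lambda>\<omega>. indicator (E k) \<omega> * exp (\<theta> * a k * ?Z k \<omega>))
          \<in> {exp (a k * (\<theta>\<^sup>2 / 2 - \<delta>)) .. exp (a k * (\<theta>\<^sup>2 / 2 + \<delta>))}))"
      using E E_tail E_mgf by blast
  qed
  then show ?thesis
    unfolding a_def .
qed

end
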